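(* Let $m\ge1$, let $\mathbf u=(u_1,\dots,u_m)$ be a vector of positive integers with $u_1<\cdots<u_m$, and let $1\le l\le m$ be an integer. Let $\mathbf w=(w_1,\dots,w_l)\in\{1,\dots,u_m\}^l$ be in non-decreasing order. The number of $\mathbf u$-parking functions $(\pi_1,\dots,\pi_m)\in\mathrm{PF}(\mathbf u)$ with $\pi_1=w_1,\dots,\pi_l=w_l$ is $$(-1)^{m-l}\sum_{\mathbf s\in S_l(\mathbf w)}\binom{m-l}{\mathbf s}\prod_{i=1}^{l+1} g_{s_i}\big(u_{s_1+\cdots+s_{i-1}+i-1};\,u_{s_1+\cdots+s_{i-1}+i},\dots,u_{s_1+\cdots+s_i+i-1}\big),$$ where $s_0=u_0=0$ and $$S_l(\mathbf w)=\Big\{\mathbf s=(s_1,\dots,s_{l+1})\in\mathbb Z_{\ge0}^{l+1}:\ u_{s_1+\cdots+s_i+i}\ge w_i\ \ \forall\, 1\le i\le l,\ \ s_1+\cdots+s_{l+1}=m-l\Big\}.$$ Moreover, this quantity is constant over all $\mathbf w$ with $w_i\le u_i$ for all $1\le i\le l$, and it is (weakly) decreasing as each $w_i$ increases past $u_i$.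
   Context: A $\mathbf u$-parking function of length $m$ is a sequence $(\pi_1,\dots,\pi_m)$ of positive integers whose non-decreasing rearrangement $(\lambda_1,\dots,\lambda_m)$ satisfies $\lambda_i\le u_i$ for all $1\le i\le m$; the set of these is $\mathrm{PF}(\mathbf u)$. $\binom{m-l}{\mathbf s}=\frac{(m-l)!}{s_1!\cdots s_{l+1}!}$ is the multinomial coefficient. Gončarov polynomials: for numbers $a_0,a_1,\dots$, $g_n(x;a_0,\dots,a_{n-1})$ ($n\ge0$) is the unique polynomial in $x$ of degree $n$ such that its $i$-th derivative in $x$ evaluated at $x=a_i$ equals $n!\,\delta_{in}$ for all $0\le i\le n$ (with $\delta$ the Kronecker delta); in particular $g_0=1$. For $s_i=0$ the list of nodes in the corresponding factor is empty and the factor is $1$. *)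

theory Defs
  imports Complex_Main "HOL-Computational_Algebra.Polynomial"
begin

text \<open>
  A vector \<open>(u\<^sub>1, \<dots>, u\<^sub>m)\<close> is given by a function on \<open>nat\<close>, of which only the values at
  \<open>1, \<dots>, m\<close> (and the convention \<open>u 0 = 0\<close>) matter. The sequences \<open>\<pi>\<close>, \<open>w\<close>, \<open>s\<close> are lists,
  so that their \<open>i\<close>-th entry is \<open>xs ! (i - 1)\<close>.
\<close>

definition parking_functions :: "nat \<Rightarrow> (nat \<Rightarrow> nat) \<Rightarrow> nat list set" where
  "parking_functions m u =
     {p. length p = m \<and> (\<forall>x\<in>set p. 0 < x) \<and> (\<forall>i\<in>{1..m}. sort p ! (i - 1) \<le> u i)}"

definition pf_with_prefix :: "nat \<Rightarrow> (nat \<Rightarrow> nat) \<Rightarrow> nat list \<Rightarrow> nat list set" where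
  "pf_with_prefix m u w = {p \<in> parking_functions m u. take (length w) p = w}"

definition goncarov_char :: "nat \<Rightarrow> (nat \<Rightarrow> real) \<Rightarrow> real poly \<Rightarrow> bool" where
  "goncarov_char n a p \<longleftrightarrow> degree p = n \<and>
     (\<forall>i\<le>n. poly ((pderiv ^^ i) p) (a i) = (if i = n then fact n else 0))"

text \<open>
  The node \<open>a n\<close> occurs in the defining condition but is irrelevant
  (see \<open>goncarov_cong\<close> below), since the \<open>n\<close>-th derivative is constant.
\<close>

definition goncarov :: "nat \<Rightarrow> (nat \<Rightarrow> real) \<Rightarrow> real poly" where
  "goncarov n a = (THE p. goncarov_char n a p)"

definition psum :: "nat list \<Rightarrow> nat \<Rightarrow> nat" where
  "psum s i = sum_list (take i s)"

definition S_set :: "nat \<Rightarrow> (nat \<Rightarrow> nat) \<Rightarrow> nat list \<Rightarrow> nat list set" where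
  "S_set m u w =
     {s. length s = length w + 1 \<and>
         (\<forall>i\<in>{1..length w}. w ! (i - 1) \<le> u (psum s i + i)) \<and>
         sum_list s = m - length w}"

definition multinom :: "nat \<Rightarrow> nat list \<Rightarrow> real" where
  "multinom n s = fact n / (\<Prod>k\<leftarrow>s. fact k)"

text \<open>
  In the \<open>i\<close>-th factor the nodes are \<open>u (psum s (i - 1) + i + j)\<close> for \<open>0 \<le> j < s\<^sub>i\<close>; the last of
  them is \<open>u (psum s i + i - 1)\<close>.
\<close>

definition goncarov_sum :: "nat \<Rightarrow> (nat \<Rightarrow> nat) \<Rightarrow> nat list \<Rightarrow> real" where
  "goncarov_sum m u w =
     (-1) ^ (m - length w) *
     (\<Sum>s\<in>S_set m u w. multinom (m - length w) s *
        (\<Prod>i = 1..length w + 1.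
           poly (goncarov (s ! (i - 1)) (\<lambda>j. real (u (psum s (i - 1) + i + j))))
                (real (u (psum s (i - 1) + (i - 1))))))"

definition prefixes :: "nat \<Rightarrow> (nat \<Rightarrow> nat) \<Rightarrow> nat \<Rightarrow> nat list set" where
  "prefixes m u l = {w. length w = l \<and> sorted w \<and> set w \<subseteq> {1..u m}}"

lemma pderiv_sum': "pderiv (\<Sum>i\<in>A. f i) = (\<Sum>i\<in>A. pderiv (f i :: real poly))"
  by (induction A rule: infinite_finite_induct) (simp_all add: pderiv_add)

lemma antideriv_exists: "\<exists>p. pderiv p = (q :: real poly)"
proof
  have "pderiv (\<Sum>i\<le>degree q. monom (coeff q i / real (Suc i)) (Suc i)) =
        (\<Sum>i\<le>degree q. monom (coeff q i) i)"
    by (simp add: pderiv_sum' pderiv_monom del: of_nat_Suc)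
  also have "\<dots> = q" by (rule poly_as_sum_of_monoms)
  finally show "pderiv (\<Sum>i\<le>degree q. monom (coeff q i / real (Suc i)) (Suc i)) = q" .
qed

lemma goncarov_char_0: "goncarov_char 0 a p \<longleftrightarrow> p = 1"
  by (auto simp: goncarov_char_def elim!: degree_eq_zeroE)

lemma goncarov_char_Suc:
  "goncarov_char (Suc n) a p \<longleftrightarrow>
     goncarov_char n (a \<circ> Suc) (smult (1 / real (Suc n)) (pderiv p)) \<and> poly p (a 0) = 0"
proof -
  let ?c = "1 / real (Suc n)"
  have smult: "(pderiv ^^ i) (smult ?c q) = smult ?c ((pderiv ^^ i) q)" for i and q :: "real poly"
    by (induction i) (simp_all add: pderiv_smult)
  have iter: "(pderiv ^^ i) (pderiv p) = (pderiv ^^ Suc i) p" for i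
    by (simp add: funpow_swap1)
  have all: "(\<forall>i\<le>Suc n. P i) \<longleftrightarrow> P 0 \<and> (\<forall>i\<le>n. P (Suc i))" for P :: "nat \<Rightarrow> bool"
    by (metis Suc_le_mono le0 not0_implies_Suc)
  have conds: "(\<forall>i\<le>Suc n. poly ((pderiv ^^ i) p) (a i) = (if i = Suc n then fact (Suc n) else 0)) \<longleftrightarrow>
     poly p (a 0) = 0 \<and> (\<forall>i\<le>n. poly ((pderiv ^^ i) (smult ?c (pderiv p))) ((a \<circ> Suc) i) =
        (if i = n then fact n else 0))"
    unfolding all smult iter by (auto simp: field_simps simp del: funpow.simps of_nat_Suc)
  have deg: "degree p = Suc n \<longleftrightarrow> degree (smult ?c (pderiv p)) = n"
    if "poly ((pderiv ^^ n) (smult ?c (pderiv p))) (a (Suc n)) = fact n"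
  proof -
    have "pderiv p \<noteq> 0"
    proof
      assume "pderiv p = 0"
      moreover have "(pderiv ^^ n) 0 = (0 :: real poly)" by (induction n) simp_all
      ultimately show False using that by simp
    qed
    then have "degree p \<noteq> 0" by (simp add: pderiv_eq_0_iff)
    then show ?thesis by (auto simp: degree_pderiv simp del: of_nat_Suc)
  qed
  show ?thesis unfolding goncarov_char_def conds using deg by auto
qed

lemma goncarov_char_ex1: "\<exists>!p. goncarov_char n a p"
proof (induction n arbitrary: a)
  case 0
  then show ?case by (simp add: goncarov_char_0)
next
  case (Suc n)
  from Suc.IH[of "a \<circ> Suc"] obtain g where g: "goncarov_char n (a \<circ> Suc) g"
    and uniq: "\<And>q. goncarov_char n (a \<circ> Suc) q \<Longrightarrow> q = g" by blast
  obtain p0 where p0: "pderiv p0 = smult (real (Suc n)) g" using antideriv_exists by blast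
  define p where "p = p0 - [:poly p0 (a 0):]"
  have p: "pderiv p = smult (real (Suc n)) g" "poly p (a 0) = 0"
    by (simp_all add: p_def p0 pderiv_diff pderiv_pCons del: of_nat_Suc)
  show ?case
  proof (rule ex1I[of _ p])
    show "goncarov_char (Suc n) a p"
      using p g by (simp add: goncarov_char_Suc del: of_nat_Suc)
  next
    fix q assume "goncarov_char (Suc n) a q"
    then have q: "smult (1 / real (Suc n)) (pderiv q) = g" "poly q (a 0) = 0"
      using uniq by (auto simp: goncarov_char_Suc)
    have "pderiv q = smult (real (Suc n)) g"
      unfolding q(1)[symmetric] by (simp del: of_nat_Suc)
    then have "pderiv (q - p) = 0" using p by (simp add: pderiv_diff)
    then obtain c where c: "q - p = [:c:]" by (auto simp: pderiv_eq_0_iff elim: degree_eq_zeroE)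
    have "poly (q - p) (a 0) = 0" using p q by simp
    with c show "q = p" by simp
  qed
qed

lemma goncarov_char_goncarov: "goncarov_char n a (goncarov n a)"
  unfolding goncarov_def using goncarov_char_ex1 by (rule theI')

lemma goncarov_cong:
  assumes "\<And>j. j < n \<Longrightarrow> a j = b j"
  shows "goncarov n a = goncarov n b"
proof -
  have "goncarov_char n a p \<longleftrightarrow> goncarov_char n b p" for p
    using assms
  proof (induction n arbitrary: a b p)
    case 0
    then show ?case by (simp add: goncarov_char_0)
  next
    case (Suc n)
    have "goncarov_char n (a \<circ> Suc) q \<longleftrightarrow> goncarov_char n (b \<circ> Suc) q" for q
      by (rule Suc.IH) (simp add: Suc.prems)
    then show ?case using Suc.prems[of 0] by (simp add: goncarov_char_Suc)
  qed
  then show ?thesis by (simp add: goncarov_def)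
qed

end

theory Submission
  imports Defs
begin

text \<open>
  A sequence is \<open>u\<close>-parking iff for every \<open>i\<close> at least \<open>i\<close> of its entries are \<open>\<le> u i\<close>. Read
  \<open>u 1 \<le> u 2 \<le> \<dots>\<close> as parking spots, an entry \<open>x\<close> being a car that takes the first
  free spot \<open>\<ge> x\<close>. Fix a sorted prefix \<open>w\<close> and let the \<open>n = m - l\<close> free entries park first. They leave
  \<open>l\<close> spots empty, and the prefix can be added iff its \<open>i\<close>-th entry is at most the \<open>i\<close>-th empty spot.
  If \<open>s\<^sub>i\<close> cars stand between consecutive empty spots, the \<open>i\<close>-th empty spot has index
  \<open>s\<^sub>1 + \<dots> + s\<^sub>i + i\<close>, so that this requirement is the one defining \<open>S_set\<close>. For a given \<open>s\<close>
  the cars are distributed to the blocks in \<open>multinom n s\<close> ways, and inside each block they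
  park exactly on the spots of that block.

  The proof peels off one block at a time. The first empty spot left by \<open>x\<close> is the only index
  \<open>i + 1\<close> such that the entries of \<open>x\<close> up to \<open>u (i + 1)\<close> are \<open>i\<close> in number and park in the
  first \<open>i\<close> spots; the larger entries see only the spots beyond it, that is, a shifted \<open>u\<close>
  (\<open>card_by_first_gap\<close>). This one decomposition is used twice.

    \<^item> With a prefix present it gives the recursion \<open>card_completions_Cons\<close> in the
      length of the prefix, and the Goncarov sum satisfies the same recursion
      (\<open>goncarov_sum_Cons\<close>).

    \<^item> Applied to all sequences of length \<open>n\<close> with entries in an interval, it expands
      \<open>(c - u 0)\<^sup>n\<close> in the numbers of parking functions inside a block. Expanding
      \<open>(c - x)\<^sup>n\<close> in Goncarov polynomials produces the same triangular system with
      \<open>(-1)\<^sup>i g\<^sub>i\<close> in place of these numbers, so the two agree (\<open>card_completions_Nil\<close>).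

  The other two claims follow from the counting criterion. If \<open>w\<^sub>i \<le> u\<^sub>i\<close> for all \<open>i\<close>, then the
  prefix fulfils the conditions for \<open>i \<le> l\<close> alone and contributes exactly \<open>l\<close> to each later one,
  so the set of admissible continuations does not depend on \<open>w\<close>; and raising entries of \<open>w\<close> can
  only lower the counts.
\<close>

section \<open>Counting entries below a threshold\<close>

definition num_le :: "nat list \<Rightarrow> nat \<Rightarrow> nat" where
  "num_le xs t = length (filter (\<lambda>x. x \<le> t) xs)"

lemma num_le_simps [simp]:
  "num_le [] t = 0"
  "num_le (x # xs) t = (if x \<le> t then Suc (num_le xs t) else num_le xs t)"
  "num_le (xs @ ys) t = num_le xs t + num_le ys t"
  by (simp_all add: num_le_def)

lemma num_le_mono: "s \<le> t \<Longrightarrow> num_le xs s \<le> num_le xs t"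
  by (induction xs) auto

lemma num_le_length: "num_le xs t \<le> length xs"
  by (simp add: num_le_def)

lemma num_le_eq_length_iff: "num_le xs t = length xs \<longleftrightarrow> (\<forall>x\<in>set xs. x \<le> t)"
  unfolding num_le_def
  by (metis filter_True length_filter_less nat_neq_iff)

lemma num_le_mset: "mset xs = mset ys \<Longrightarrow> num_le xs t = num_le ys t"
  unfolding num_le_def by (metis mset_filter size_mset)

lemma sorted_nth_le_iff_num_le:
  assumes "sorted xs" "i < length xs"
  shows "xs ! i \<le> t \<longleftrightarrow> i < num_le xs t"
  using assms
proof (induction xs arbitrary: i)
  case (Cons y ys)
  show ?case
  proof (cases "y \<le> t")
    case True
    with Cons show ?thesis by (cases i) auto
  next
    case False
    with Cons.prems have *: "\<forall>x\<in>set (y # ys). \<not> x \<le> t" by auto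
    then have "num_le (y # ys) t = 0"
      unfolding num_le_def by (simp only: filter_False list.size)
    moreover have "\<not> (y # ys) ! i \<le> t" using * nth_mem[OF Cons.prems(2)] by blast
    ultimately show ?thesis by simp
  qed
qed simp

lemma num_le_filter_low:
  "s \<le> t \<Longrightarrow> num_le (filter (\<lambda>x. x \<le> t) xs) s = num_le xs s"
  by (induction xs) auto

lemma num_le_filter_high:
  "t \<le> s \<Longrightarrow> num_le xs s = num_le xs t + num_le (filter (\<lambda>x. t < x) xs) s"
  by (induction xs) auto

lemma length_filter_high:
  "length xs = num_le xs t + length (filter (\<lambda>x. t < x) xs)"
  by (induction xs) auto

section \<open>Completions of a prefix\<close>

text \<open>
  The parking condition is stated by counting, which makes it insensitive to the order of the
  entries. The entries of \<open>x\<close> have to exceed \<open>u 0\<close> (positivity, when \<open>u 0 = 0\<close>) so that the part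
  of a sequence beyond the spot \<open>u k\<close> is again a completion, for \<open>u\<close> shifted by \<open>k\<close>. The entries
  of \<open>w\<close> have no such lower bound: a prefix car still waiting may prefer a spot that has
  already been passed.
\<close>

definition completions :: "(nat \<Rightarrow> nat) \<Rightarrow> nat \<Rightarrow> nat list \<Rightarrow> nat list set" where
  "completions u n w =
     {x. length x = n \<and> (\<forall>y\<in>set x. u 0 < y) \<and>
         (\<forall>j\<in>{1..n + length w}. j \<le> num_le (x @ w) (u j))}"

lemma completions_bounded:
  assumes "x \<in> completions u n w" "y \<in> set x"
  shows "y \<le> u (n + length w)"
proof -
  have len: "length (x @ w) = n + length w" and "1 \<le> n"
    using assms by (auto simp: completions_def Suc_le_eq)
  then have "n + length w \<le> num_le (x @ w) (u (n + length w))"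
    using assms(1) by (auto simp: completions_def)
  then have "num_le (x @ w) (u (n + length w)) = length (x @ w)"
    using num_le_length[of "x @ w" "u (n + length w)"] len by linarith
  then show ?thesis using assms(2) by (simp only: num_le_eq_length_iff) auto
qed

lemma finite_completions: "finite (completions u n w)"
proof (rule finite_subset)
  show "completions u n w \<subseteq> {x. set x \<subseteq> {..u (n + length w)} \<and> length x = n}"
    using completions_bounded by (auto simp: completions_def)
  show "finite {x. set x \<subseteq> {..u (n + length w)} \<and> length x = n}"
    by (rule finite_lists_length_eq) simp
qed

lemma card_pf_with_prefix:
  assumes "u 0 = 0" "length w \<le> m" "\<forall>y\<in>set w. 0 < y"
  shows "card (pf_with_prefix m u w) = card (completions u (m - length w) w)"
proof -
  have sort_iff: "(\<forall>i\<in>{1..m}. sort p ! (i - 1) \<le> u i) \<longleftrightarrow> (\<forall>j\<in>{1..m}. j \<le> num_le p (u j))"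
    if "length p = m" for p
  proof (rule ball_cong[OF refl])
    fix i assume i: "i \<in> {1..m}"
    then have "sort p ! (i - 1) \<le> u i \<longleftrightarrow> i - 1 < num_le (sort p) (u i)"
      using that by (intro sorted_nth_le_iff_num_le) auto
    also have "num_le (sort p) (u i) = num_le p (u i)" by (rule num_le_mset) simp
    finally show "sort p ! (i - 1) \<le> u i \<longleftrightarrow> i \<le> num_le p (u i)" using i by auto
  qed
  have mem: "w @ x \<in> pf_with_prefix m u w \<longleftrightarrow> x \<in> completions u (m - length w) w" for x
  proof (cases "length x = m - length w")
    case True
    then have "length (w @ x) = m" using assms(2) by simp
    then show ?thesis using True assms sort_iff[of "w @ x"]
      by (auto simp: pf_with_prefix_def parking_functions_def completions_def add.commute)
  next
    case False
    then show ?thesis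
      by (auto simp: pf_with_prefix_def parking_functions_def completions_def)
  qed
  have "pf_with_prefix m u w = (@) w ` completions u (m - length w) w"
  proof (intro equalityI subsetI)
    fix p assume p: "p \<in> pf_with_prefix m u w"
    then have "p = w @ drop (length w) p"
      by (metis (mono_tags, lifting) append_take_drop_id mem_Collect_eq pf_with_prefix_def)
    with p mem show "p \<in> (@) w ` completions u (m - length w) w" by (metis image_eqI)
  qed (use mem in auto)
  then show ?thesis by (simp add: card_image inj_on_def)
qed

section \<open>Decomposition at the first gap\<close>

text \<open>
  A list is determined by its entries \<open>\<le> t\<close>, its entries \<open>> t\<close>, and the way in which the two
  sublists are shuffled; the shuffles of two lists without common entries are counted by a
  binomial coefficient.
\<close>

lemma card_interleavings:
  fixes t :: nat
  assumes "finite A" "finite B"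
    and A: "\<And>y. y \<in> A \<Longrightarrow> length y = i \<and> (\<forall>v\<in>set y. v \<le> t)"
    and B: "\<And>z. z \<in> B \<Longrightarrow> length z = r \<and> (\<forall>v\<in>set z. t < v)"
  shows "card {x. filter (\<lambda>v. v \<le> t) x \<in> A \<and> filter (\<lambda>v. t < v) x \<in> B} =
         ((i + r) choose i) * card A * card B"
    and "finite {x. filter (\<lambda>v. v \<le> t) x \<in> A \<and> filter (\<lambda>v. t < v) x \<in> B}"
proof -
  have shuf: "x \<in> shuffles y z \<longleftrightarrow> filter (\<lambda>v. v \<le> t) x = y \<and> filter (\<lambda>v. t < v) x = z"
    if "y \<in> A" "z \<in> B" for x y z
  proof
    assume x: "x \<in> shuffles y z"
    have y: "filter (\<lambda>v. v \<le> t) y = y" "filter (\<lambda>v. t < v) y = []"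
      using A[OF that(1)] by (auto simp: filter_empty_conv filter_id_conv leD)
    have z: "filter (\<lambda>v. v \<le> t) z = []" "filter (\<lambda>v. t < v) z = z"
      using B[OF that(2)] by (auto simp: filter_empty_conv filter_id_conv leD)
    have "filter (\<lambda>v. v \<le> t) x \<in> shuffles y []" "filter (\<lambda>v. t < v) x \<in> shuffles [] z"
      using imageI[OF x, of "filter (\<lambda>v. v \<le> t)"] imageI[OF x, of "filter (\<lambda>v. t < v)"]
      by (simp_all add: filter_shuffles y z)
    then show "filter (\<lambda>v. v \<le> t) x = y \<and> filter (\<lambda>v. t < v) x = z" by simp
  next
    assume "filter (\<lambda>v. v \<le> t) x = y \<and> filter (\<lambda>v. t < v) x = z"
    then show "x \<in> shuffles y z"
      using partition_in_shuffles[of x "\<lambda>v. v \<le> t"] by (simp add: not_le)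
  qed
  have eq: "{x. filter (\<lambda>v. v \<le> t) x \<in> A \<and> filter (\<lambda>v. t < v) x \<in> B} =
        (\<Union>yz\<in>A \<times> B. shuffles (fst yz) (snd yz))"
    using shuf by auto
  show "finite {x. filter (\<lambda>v. v \<le> t) x \<in> A \<and> filter (\<lambda>v. t < v) x \<in> B}"
    unfolding eq using assms(1,2) by auto
  have "card (\<Union>yz\<in>A \<times> B. shuffles (fst yz) (snd yz)) =
        (\<Sum>yz\<in>A \<times> B. card (shuffles (fst yz) (snd yz)))"
  proof (rule card_UN_disjoint)
    show "\<forall>yz\<in>A \<times> B. \<forall>yz'\<in>A \<times> B. yz \<noteq> yz' \<longrightarrow>
            shuffles (fst yz) (snd yz) \<inter> shuffles (fst yz') (snd yz') = {}"
      using shuf by (auto 0 3)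
  qed (use assms(1,2) in auto)
  also have "\<dots> = (\<Sum>yz\<in>A \<times> B. (i + r) choose i)"
  proof (rule sum.cong[OF refl])
    fix yz assume "yz \<in> A \<times> B"
    then have "length (fst yz) = i" "length (snd yz) = r" "set (fst yz) \<inter> set (snd yz) = {}"
      using A[of "fst yz"] B[of "snd yz"] by (fastforce simp: leD)+
    then show "card (shuffles (fst yz) (snd yz)) = (i + r) choose i"
      by (simp add: card_disjoint_shuffles)
  qed
  finally show "card {x. filter (\<lambda>v. v \<le> t) x \<in> A \<and> filter (\<lambda>v. t < v) x \<in> B} =
         ((i + r) choose i) * card A * card B"
    unfolding eq by (simp add: card_cartesian_product)
qed

text \<open>
  The entries up to \<open>u (i + 1)\<close> already decide all counts at \<open>u 1, \<dots>, u (i + 1)\<close>. So if they fill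
  the first \<open>i\<close> spots, then \<open>x\<close> itself satisfies the first \<open>i\<close> parking conditions and
  fails the next one, which is what it means for \<open>i + 1\<close> to be the first empty spot.
\<close>

lemma low_part_completionsD:
  assumes u: "mono u" and low: "filter (\<lambda>y. y \<le> u (Suc i)) x \<in> completions u i []"
  shows "num_le x (u (Suc i)) = i" and "j \<in> {1..i} \<Longrightarrow> j \<le> num_le x (u j)"
proof -
  show "num_le x (u (Suc i)) = i" using low by (simp add: completions_def num_le_def)
  assume j: "j \<in> {1..i}"
  have "j \<le> num_le (filter (\<lambda>y. y \<le> u (Suc i)) x) (u j)"
    using low j unfolding completions_def by simp
  also have "\<dots> = num_le x (u j)"
    using u j by (intro num_le_filter_low) (simp add: monoD)
  finally show "j \<le> num_le x (u j)" .
qed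

text \<open>
  Classify the members of \<open>X\<close> by the number \<open>i\<close> of spots before the first empty one, where \<open>B i\<close>
  is the set of admissible sublists of entries beyond the gap. Such an \<open>i\<close> exists and is at
  most \<open>n\<close> because \<open>n\<close> cars cannot fill \<open>n + 1\<close> spots, and it is unique because the first gap is.
\<close>

lemma card_by_first_gap:
  assumes u: "mono u"
    and fin: "\<And>i. finite (B i)"
    and B: "\<And>i z. i \<le> n \<Longrightarrow> z \<in> B i \<Longrightarrow> length z = n - i \<and> (\<forall>y\<in>set z. u (Suc i) < y)"
    and X: "\<And>x. x \<in> X \<Longrightarrow> length x = n \<and> (\<forall>y\<in>set x. u 0 < y)"
    and split: "\<And>i x. \<lbrakk>i \<le> n; length x = n; \<forall>y\<in>set x. u 0 < y;
        filter (\<lambda>y. y \<le> u (Suc i)) x \<in> completions u i []\<rbrakk> \<Longrightarrow>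
        x \<in> X \<longleftrightarrow> filter (\<lambda>y. u (Suc i) < y) x \<in> B i"
  shows "card X = (\<Sum>i\<le>n. (n choose i) * card (completions u i []) * card (B i))"
proof -
  define G where "G i = {x. filter (\<lambda>y. y \<le> u (Suc i)) x \<in> completions u i [] \<and>
                            filter (\<lambda>y. u (Suc i) < y) x \<in> B i}" for i
  have A: "length y = i \<and> (\<forall>v\<in>set y. v \<le> u (Suc i))" if "y \<in> completions u i []" for y i
  proof -
    have "v \<le> u (Suc i)" if "v \<in> set y" for v
      using completions_bounded[OF \<open>y \<in> _\<close> that] monoD[OF u, of i "Suc i"] by simp
    with that show ?thesis by (auto simp: completions_def)
  qed
  have G: "card (G i) = (n choose i) * card (completions u i []) * card (B i)" "finite (G i)"
    if "i \<le> n" for i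
    using card_interleavings[OF finite_completions fin A B[OF that]]
    by (simp_all add: G_def that)
  have G_props: "length x = n" "\<forall>y\<in>set x. u 0 < y" "num_le x (u (Suc i)) = i"
    "\<And>j. j \<in> {1..i} \<Longrightarrow> j \<le> num_le x (u j)" if "x \<in> G i" "i \<le> n" for x i
  proof -
    have low: "filter (\<lambda>y. y \<le> u (Suc i)) x \<in> completions u i []"
      and high: "filter (\<lambda>y. u (Suc i) < y) x \<in> B i" using that by (auto simp: G_def)
    show c: "num_le x (u (Suc i)) = i" by (rule low_part_completionsD(1)[OF u low])
    show "length x = n"
      using length_filter_high[of x "u (Suc i)"] c conjunct1[OF B[OF that(2) high]] that(2) by linarith
    have "u 0 \<le> u (Suc i)" using u by (simp add: monoD)
    moreover have "u 0 < y" if "y \<in> set x" "y \<le> u (Suc i)" for y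
      using low that by (simp add: completions_def)
    ultimately show "\<forall>y\<in>set x. u 0 < y" by (meson le_less_trans not_le)
    show "j \<le> num_le x (u j)" if "j \<in> {1..i}" for j
      using that by (rule low_part_completionsD(2)[OF u low])
  qed
  have "X = (\<Union>i\<in>{..n}. G i)"
  proof (intro equalityI subsetI)
    fix x assume x: "x \<in> X"
    define i where "i = (LEAST i. num_le x (u (Suc i)) \<le> i)"
    have ex: "num_le x (u (Suc n)) \<le> n" using X[OF x] num_le_length[of x] by simp
    have "i \<le> n" unfolding i_def using ex by (rule Least_le)
    \<comment> \<open>Up to here the counts keep pace with the index, so the count at the gap is \<open>i\<close> exactly.\<close>
    have up: "num_le x (u (Suc i)) \<le> i" unfolding i_def using ex by (rule LeastI)
    have below: "j \<le> num_le x (u j)" if "j \<in> {1..i}" for j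
    proof -
      have "\<not> num_le x (u (Suc (j - 1))) \<le> j - 1"
        using that by (intro not_less_Least) (auto simp: i_def)
      with that show ?thesis by simp
    qed
    have "i \<le> num_le x (u (Suc i))"
    proof (cases "i = 0")
      case False
      then have "i \<le> num_le x (u i)" by (intro below) simp
      also have "\<dots> \<le> num_le x (u (Suc i))" by (intro num_le_mono monoD[OF u]) simp
      finally show ?thesis .
    qed simp
    with up have len: "length (filter (\<lambda>y. y \<le> u (Suc i)) x) = i" by (simp add: num_le_def)
    have low: "filter (\<lambda>y. y \<le> u (Suc i)) x \<in> completions u i []"
      using len X[OF x] below by (auto simp: completions_def num_le_filter_low monoD[OF u])
    with split[of i x] X[OF x] x \<open>i \<le> n\<close> have "x \<in> G i" by (simp add: G_def)
    with \<open>i \<le> n\<close> show "x \<in> (\<Union>i\<in>{..n}. G i)" by blast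
  next
    fix x assume "x \<in> (\<Union>i\<in>{..n}. G i)"
    then obtain i where i: "i \<le> n" "x \<in> G i" by blast
    with split[OF i(1)] G_props(1,2)[OF i(2,1)] show "x \<in> X" by (simp add: G_def)
  qed
  moreover have "G i \<inter> G j = {}" if "i < j" "j \<le> n" for i j
    using G_props(3)[of _ i] G_props(4)[of _ j "Suc i"] that by fastforce
  then have "\<forall>i\<in>{..n}. \<forall>j\<in>{..n}. i \<noteq> j \<longrightarrow> G i \<inter> G j = {}"
    by (metis Int_commute atMost_iff linorder_neqE_nat)
  ultimately have "card X = (\<Sum>i\<le>n. card (G i))"
    using G(2) by (simp add: card_UN_disjoint)
  also have "\<dots> = (\<Sum>i\<le>n. (n choose i) * card (completions u i []) * card (B i))"
    using G(1) by simp
  finally show ?thesis .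
qed

lemma ball_atLeastAtMost_split:
  "(\<forall>j\<in>{1..Suc i + r}. P j) \<longleftrightarrow>
     (\<forall>j\<in>{1..i}. P j) \<and> P (Suc i) \<and> (\<forall>j\<in>{1..r}. P (Suc i + j))" (is "?L \<longleftrightarrow> ?R")
proof
  assume R: ?R
  show ?L
  proof
    fix j assume j: "j \<in> {1..Suc i + r}"
    show "P j"
    proof (cases "j \<le> Suc i")
      case True
      with R j show ?thesis by (cases "j = Suc i") auto
    next
      case False
      with j have "j - Suc i \<in> {1..r}" "Suc i + (j - Suc i) = j" by auto
      with R show ?thesis by metis
    qed
  qed
qed auto

text \<open>
  The smallest prefix car \<open>w\<close> must take the first gap left by the free cars: otherwise, as \<open>w\<close> is
  minimal in the prefix, no other prefix car could take it either. This is the condition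
  \<open>w \<le> u (i + 1)\<close>; afterwards the rest of the prefix faces the same problem beyond the gap.
\<close>

lemma card_completions_Cons:
  assumes u: "mono u" and w: "sorted (w # ws)"
  shows "card (completions u n (w # ws)) =
    (\<Sum>i\<in>{i\<in>{..n}. w \<le> u (Suc i)}. (n choose i) * card (completions u i []) *
       card (completions (\<lambda>j. u (Suc i + j)) (n - i) ws))"
proof -
  define B where "B i = (if w \<le> u (Suc i) then completions (\<lambda>j. u (Suc i + j)) (n - i) ws else {})" for i
  have "card (completions u n (w # ws)) =
        (\<Sum>i\<le>n. (n choose i) * card (completions u i []) * card (B i))"
  proof (rule card_by_first_gap[OF u])
    fix i x
    assume i: "i \<le> n" and len: "length x = n" and pos: "\<forall>y\<in>set x. u 0 < y"
      and low: "filter (\<lambda>y. y \<le> u (Suc i)) x \<in> completions u i []"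
    let ?z = "filter (\<lambda>y. u (Suc i) < y) x"
    note c = low_part_completionsD(1)[OF u low] and below = low_part_completionsD(2)[OF u low]
    have lenz: "length ?z = n - i" using length_filter_high[of x "u (Suc i)"] c len by simp
    have above: "num_le x (u (Suc i + j)) = i + num_le ?z (u (Suc i + j))" for j
      using num_le_filter_high[of "u (Suc i)" "u (Suc i + j)" x] c u by (simp add: monoD)
    \<comment> \<open>The condition at the gap itself: one prefix car has to supply the missing entry.\<close>
    have first: "Suc i \<le> num_le (x @ w # ws) (u (Suc i)) \<longleftrightarrow> w \<le> u (Suc i)"
    proof (cases "w \<le> u (Suc i)")
      case False
      then have "num_le ws (u (Suc i)) = 0"
        using w by (auto simp: num_le_def filter_empty_conv)
      with False c show ?thesis by simp
    qed (simp add: c)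
    \<comment> \<open>Beyond the gap, the \<open>i\<close> low entries and \<open>w\<close> account for \<open>Suc i\<close> on both sides.\<close>
    have later: "Suc i + j \<le> num_le (x @ w # ws) (u (Suc i + j)) \<longleftrightarrow>
        j \<le> num_le (?z @ ws) (u (Suc i + j))" if "w \<le> u (Suc i)" for j
    proof -
      have "w \<le> u (Suc i + j)" using that monoD[OF u, of "Suc i" "Suc i + j"] by simp
      then show ?thesis using above[of j] by simp
    qed
    have "x \<in> completions u n (w # ws) \<longleftrightarrow>
        (\<forall>j\<in>{1..n + Suc (length ws)}. j \<le> num_le (x @ w # ws) (u j))"
      using len pos by (simp add: completions_def)
    also have "n + Suc (length ws) = Suc i + (n - i + length ws)" using i by simp
    also have "(\<forall>j\<in>{1..\<dots>}. j \<le> num_le (x @ w # ws) (u j)) \<longleftrightarrow>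
        w \<le> u (Suc i) \<and> (\<forall>j\<in>{1..n - i + length ws}. j \<le> num_le (?z @ ws) (u (Suc i + j)))"
    proof -
      have "\<forall>j\<in>{1..i}. j \<le> num_le (x @ w # ws) (u j)"
        using below by (fastforce simp: trans_le_add1)
      then show ?thesis
        unfolding ball_atLeastAtMost_split first
        by (cases "w \<le> u (Suc i)"; simp only: later simp_thms; blast)
    qed
    also have "\<dots> \<longleftrightarrow> ?z \<in> B i" using lenz by (auto simp: B_def completions_def)
    finally show "x \<in> completions u n (w # ws) \<longleftrightarrow> ?z \<in> B i" .
  next
    show "finite (B i)" for i by (simp add: B_def finite_completions)
  qed (auto simp: B_def completions_def split: if_splits)
  also have "\<dots> = (\<Sum>i\<in>{..n}. if w \<le> u (Suc i) then (n choose i) * card (completions u i []) *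
       card (completions (\<lambda>j. u (Suc i + j)) (n - i) ws) else 0)"
    by (rule sum.cong) (auto simp: B_def)
  also have "\<dots> = (\<Sum>i\<in>{i\<in>{..n}. w \<le> u (Suc i)}. (n choose i) * card (completions u i []) *
       card (completions (\<lambda>j. u (Suc i + j)) (n - i) ws))"
    by (rule sum.inter_filter[symmetric]) simp
  finally show ?thesis .
qed

text \<open>
  Here the entries beyond the gap are arbitrary, up to the bound \<open>u (n + 1)\<close>. This bound is chosen
  so that the differences on the right never truncate, and the term for \<open>i = n\<close>
  is the number of parking functions itself: the identity determines these numbers
  recursively.
\<close>

lemma power_interval_by_first_gap:
  assumes u: "mono u"
  shows "(u (Suc n) - u 0) ^ n =
    (\<Sum>i\<le>n. (n choose i) * card (completions u i []) * (u (Suc n) - u (Suc i)) ^ (n - i))"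
proof -
  define L where "L a r = {x. set x \<subseteq> {a<..u (Suc n)} \<and> length x = r}" for a r
  have card_L: "card (L a r) = (u (Suc n) - a) ^ r" for a r
    by (simp add: L_def card_lists_length_eq)
  have "card (L (u 0) n) =
        (\<Sum>i\<le>n. (n choose i) * card (completions u i []) * card (L (u (Suc i)) (n - i)))"
  proof (rule card_by_first_gap[OF u])
    fix i x
    assume i: "i \<le> n" and len: "length x = n" and pos: "\<forall>y\<in>set x. u 0 < y"
      and low: "filter (\<lambda>y. y \<le> u (Suc i)) x \<in> completions u i []"
    note c = low_part_completionsD(1)[OF u low]
    have "u (Suc i) \<le> u (Suc n)" using i u by (simp add: monoD)
    then show "x \<in> L (u 0) n \<longleftrightarrow> filter (\<lambda>y. u (Suc i) < y) x \<in> L (u (Suc i)) (n - i)"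
      using length_filter_high[of x "u (Suc i)"] c len pos
      by (auto simp: L_def subset_iff)
  qed (auto simp: L_def finite_lists_length_eq)
  then show ?thesis by (simp add: card_L)
qed

section \<open>Goncarov polynomials\<close>

lemma goncarov_0 [simp]: "goncarov 0 a = 1"
  using goncarov_char_goncarov[of 0 a] by (simp add: goncarov_char_0)

lemma poly_goncarov_Suc_node: "poly (goncarov (Suc n) a) (a 0) = 0"
  and pderiv_goncarov_Suc:
    "pderiv (goncarov (Suc n) a) = smult (real (Suc n)) (goncarov n (a \<circ> Suc))"
proof -
  have c: "goncarov_char n (a \<circ> Suc) (smult (1 / real (Suc n)) (pderiv (goncarov (Suc n) a)))"
    and z: "poly (goncarov (Suc n) a) (a 0) = 0"
    using goncarov_char_goncarov[of "Suc n" a] unfolding goncarov_char_Suc by auto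
  show "poly (goncarov (Suc n) a) (a 0) = 0" by (rule z)
  have "smult (1 / real (Suc n)) (pderiv (goncarov (Suc n) a)) = goncarov n (a \<circ> Suc)"
    using goncarov_char_ex1 c goncarov_char_goncarov by blast
  moreover have "pderiv (goncarov (Suc n) a) =
      smult (real (Suc n)) (smult (1 / real (Suc n)) (pderiv (goncarov (Suc n) a)))"
    by (simp del: of_nat_Suc)
  ultimately show "pderiv (goncarov (Suc n) a) = smult (real (Suc n)) (goncarov n (a \<circ> Suc))"
    by simp
qed

text \<open>
  The functionals \<open>p \<mapsto> p\<^sup>(\<^sup>i\<^sup>) (a\<^sub>i)\<close> are dual to the Goncarov polynomials up to the factor
  \<open>i!\<close>. Differentiation shifts the nodes and lowers the index of each Goncarov polynomial, which
  reduces the claim to a smaller degree up to a constant; the constant is fixed by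
  evaluating at \<open>a 0\<close>, where all Goncarov polynomials of positive degree vanish.
\<close>

lemma goncarov_expansion:
  assumes "degree p \<le> n"
  shows "p = (\<Sum>i\<le>n. smult (poly ((pderiv ^^ i) p) (a i) / fact i) (goncarov i a))"
  using assms
proof (induction n arbitrary: p a)
  case 0
  then show ?case by (auto elim!: degree_eq_zeroE)
next
  case (Suc n)
  define q where
    "q = (\<Sum>i\<le>Suc n. smult (poly ((pderiv ^^ i) p) (a i) / fact i) (goncarov i a))"
  have q_split: "q = smult (poly p (a 0)) 1 +
      (\<Sum>i\<le>n. smult (poly ((pderiv ^^ Suc i) p) (a (Suc i)) / fact (Suc i)) (goncarov (Suc i) a))"
    unfolding q_def by (subst sum.atMost_Suc_shift) simp
  have "degree (pderiv p) \<le> n" using Suc.prems by (simp add: degree_pderiv)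
  from Suc.IH[OF this, of "a \<circ> Suc"]
  have "pderiv p = (\<Sum>i\<le>n. smult (poly ((pderiv ^^ Suc i) p) (a (Suc i)) / fact i)
      (goncarov i (a \<circ> Suc)))"
    by (simp add: funpow_swap1 comp_def)
  also have "\<dots> = pderiv q"
    unfolding q_split pderiv_add pderiv_sum' pderiv_smult pderiv_goncarov_Suc
    by (simp add: field_simps del: of_nat_Suc funpow.simps)
  finally have "pderiv (p - q) = 0" by (simp add: pderiv_diff)
  then obtain c where c: "p - q = [:c:]" by (auto simp: pderiv_eq_0_iff elim: degree_eq_zeroE)
  have "poly q (a 0) = poly p (a 0)"
    unfolding q_split by (simp add: poly_sum poly_goncarov_Suc_node)
  then have "poly (p - q) (a 0) = 0" by simp
  with c have "p - q = 0" by simp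
  then show ?case by (simp add: q_def)
qed

lemma pderiv_iter_linear_power:
  assumes "i \<le> n"
  shows "(pderiv ^^ i) ([:c, -1:] ^ n) =
    smult ((-1) ^ i * fact n / fact (n - i)) ([:c, -1 :: real:] ^ (n - i))"
  using assms
proof (induction i)
  case (Suc i)
  then obtain k where k: "n - i = Suc k" by (metis Suc_diff_Suc Suc_le_lessD)
  then have "n - Suc i = k" by simp
  then show ?case using Suc k
    by (simp add: pderiv_smult pderiv_power_Suc pderiv_pCons field_simps del: of_nat_Suc power_Suc)
       (simp add: field_simps)
qed simp

text \<open>
  The Goncarov expansion of \<open>(c - x)\<^sup>n\<close>, the analytic counterpart of
  \<open>power_interval_by_first_gap\<close> when \<open>a i = u (i + 1)\<close>, \<open>x = u 0\<close> and \<open>c = u (n + 1)\<close>.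
\<close>

lemma goncarov_binomial_identity:
  "(c - x) ^ n =
    (\<Sum>i\<le>n. real (n choose i) * ((-1) ^ i * poly (goncarov i a) x) * (c - a i) ^ (n - i))"
proof -
  have "degree ([:c, -1:] ^ n) \<le> n" using degree_power_le[of "[:c, -1:]" n] by simp
  from arg_cong[where f = "\<lambda>p. poly p x", OF goncarov_expansion[OF this, of a]]
  have "(c - x) ^ n = (\<Sum>i\<le>n. poly ((pderiv ^^ i) ([:c, -1:] ^ n)) (a i) / fact i * poly (goncarov i a) x)"
    by (simp add: poly_sum)
  also have "\<dots> = (\<Sum>i\<le>n. real (n choose i) * ((-1) ^ i * poly (goncarov i a) x) * (c - a i) ^ (n - i))"
    by (rule sum.cong) (auto simp: pderiv_iter_linear_power binomial_fact field_simps)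
  finally show ?thesis .
qed

text \<open>
  Both sides solve the same triangular recursion, in which the unknown of index \<open>n\<close>
  has coefficient \<open>1\<close>.
\<close>

lemma card_completions_Nil:
  assumes u: "mono u"
  shows "real (card (completions u n [])) =
    (-1) ^ n * poly (goncarov n (\<lambda>j. real (u (Suc j)))) (real (u 0))"
proof (induction n rule: less_induct)
  case (less n)
  let ?h = "\<lambda>i. real (card (completions u i []))"
  let ?g = "\<lambda>i. (-1) ^ i * poly (goncarov i (\<lambda>j. real (u (Suc j)))) (real (u 0))"
  let ?r = "\<lambda>i. (real (u (Suc n)) - real (u (Suc i))) ^ (n - i)"
  have sub: "real (u (Suc n) - u i) = real (u (Suc n)) - real (u i)" if "i \<le> Suc n" for i
    using monoD[OF u that] by simp
  have "(\<Sum>i\<le>n. real (n choose i) * ?h i * ?r i) = real ((u (Suc n) - u 0) ^ n)"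
    unfolding power_interval_by_first_gap[OF u] by (simp add: sub)
  also have "\<dots> = (\<Sum>i\<le>n. real (n choose i) * ?g i * ?r i)"
    using goncarov_binomial_identity[of "real (u (Suc n))" "real (u 0)" n] by (simp add: sub)
  finally have "(\<Sum>i\<le>n. real (n choose i) * ?h i * ?r i) = (\<Sum>i\<le>n. real (n choose i) * ?g i * ?r i)" .
  moreover have "(\<Sum>i<n. real (n choose i) * ?h i * ?r i) = (\<Sum>i<n. real (n choose i) * ?g i * ?r i)"
    by (rule sum.cong) (simp_all add: less.IH)
  ultimately show ?case
    by (simp flip: lessThan_Suc_atMost)
qed

section \<open>The Goncarov sum\<close>

lemma S_set_Nil: "S_set n u [] = {[n]}"
  by (auto simp: S_set_def length_Suc_conv)

lemma goncarov_sum_Nil: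
  "goncarov_sum n u [] = (-1) ^ n * poly (goncarov n (\<lambda>j. real (u (Suc j)))) (real (u 0))"
  by (simp add: goncarov_sum_def S_set_Nil multinom_def psum_def)

lemma psum_0 [simp]: "psum s 0 = 0"
  by (simp add: psum_def)

lemma psum_Cons_Suc [simp]: "psum (i # s) (Suc j) = i + psum s j"
  by (simp add: psum_def)

text \<open>
  Splitting off the first block size \<open>i\<close>: the condition on \<open>w\<close> involves only \<open>i\<close>, and the
  remaining conditions refer to the spots beyond index \<open>i + 1\<close>.
\<close>

lemma S_set_Cons:
  "S_set (n + Suc (length ws)) u (w # ws) =
    (\<Union>i\<in>{i\<in>{..n}. w \<le> u (Suc i)}. (#) i ` S_set (n - i + length ws) (\<lambda>j. u (Suc i + j)) ws)"
  (is "?L = ?R")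
proof -
  have ball: "(\<forall>j\<in>{1..Suc k}. P j) \<longleftrightarrow> P 1 \<and> (\<forall>j\<in>{1..k}. P (Suc j))" for k and P :: "nat \<Rightarrow> bool"
    using ball_atLeastAtMost_split[of 0 k P] by simp
  have mem: "i # s \<in> ?L \<longleftrightarrow> i \<le> n \<and> w \<le> u (Suc i) \<and>
      s \<in> S_set (n - i + length ws) (\<lambda>j. u (Suc i + j)) ws" for i s
    unfolding S_set_def mem_Collect_eq length_Cons ball
    by (auto simp: nth_Cons' add.assoc)
  show ?thesis
  proof (intro equalityI subsetI)
    fix s assume s: "s \<in> ?L"
    then obtain i s' where "s = i # s'" by (cases s) (auto simp: S_set_def)
    with s mem show "s \<in> ?R" by blast
  next
    fix s assume "s \<in> ?R"
    with mem show "s \<in> ?L" by blast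
  qed
qed

lemma finite_S_set: "finite (S_set m u w)"
proof (rule finite_subset)
  show "S_set m u w \<subseteq> {s. set s \<subseteq> {..m} \<and> length s = Suc (length w)}"
    using member_le_sum_list by (fastforce simp: S_set_def)
  show "finite {s. set s \<subseteq> {..m} \<and> length s = Suc (length w)}"
    by (rule finite_lists_length_eq) simp
qed

lemma multinom_Cons:
  "i \<le> n \<Longrightarrow> multinom n (i # s) = real (n choose i) * multinom (n - i) s"
  by (simp add: multinom_def binomial_fact)

text \<open>
  The summand is multiplicative over the blocks of \<open>s\<close>, so it factors into the contribution of the
  first block and a summand for the shifted \<open>u\<close>; the sign and the multinomial coefficient split
  in the same way.
\<close>

lemma goncarov_sum_Cons:
  "goncarov_sum (n + Suc (length ws)) u (w # ws) =
    (\<Sum>i\<in>{i\<in>{..n}. w \<le> u (Suc i)}. real (n choose i) *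
       ((-1) ^ i * poly (goncarov i (\<lambda>j. real (u (Suc j)))) (real (u 0))) *
       goncarov_sum (n - i + length ws) (\<lambda>j. u (Suc i + j)) ws)"
proof -
  \<comment> \<open>\<open>T v s k\<close> is the Goncarov factor of the \<open>k\<close>-th block and \<open>f\<close> the whole summand, with the
      parameters that change in the recursion made explicit.\<close>
  define T where "T v s k = poly (goncarov (s ! (k - 1)) (\<lambda>j. real (v (psum s (k - 1) + k + j))))
      (real (v (psum s (k - 1) + (k - 1))))" for v :: "nat \<Rightarrow> nat" and s k
  define f where "f N v l s = multinom N s * (\<Prod>k = 1..l + 1. T v s k)" for N v l s
  let ?I = "{i\<in>{..n}. w \<le> u (Suc i)}"
  let ?S = "\<lambda>i. S_set (n - i + length ws) (\<lambda>j. u (Suc i + j)) ws"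
  have gs: "goncarov_sum (N + length v') v v' = (-1) ^ N * (\<Sum>s\<in>S_set (N + length v') v v'. f N v (length v') s)"
    for N v v' by (simp add: goncarov_sum_def f_def T_def)
  have T1: "T u (i # s) 1 = poly (goncarov i (\<lambda>j. real (u (Suc j)))) (real (u 0))" for i s
    by (simp add: T_def)
  have T2: "T u (i # s) (Suc k) = T (\<lambda>j. u (Suc i + j)) s k" if "k \<ge> 1" for i s k
    using that by (cases k) (simp_all add: T_def add_ac)
  have f_Cons: "f n u (Suc (length ws)) (i # s) =
      real (n choose i) * T u (i # s) 1 * f (n - i) (\<lambda>j. u (Suc i + j)) (length ws) s"
    if "i \<le> n" for i s
  proof -
    have "(\<Prod>k = 1..Suc (length ws) + 1. T u (i # s) k) =
        T u (i # s) 1 * (\<Prod>k = 1..length ws + 1. T u (i # s) (Suc k))"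
      by (subst prod.atLeast_Suc_atMost) (simp_all add: prod.shift_bounds_cl_Suc_ivl del: prod.cl_ivl_Suc)
    also have "(\<Prod>k = 1..length ws + 1. T u (i # s) (Suc k)) =
        (\<Prod>k = 1..length ws + 1. T (\<lambda>j. u (Suc i + j)) s k)"
      by (rule prod.cong) (auto simp only: T2 atLeastAtMost_iff)
    finally show ?thesis using that by (simp add: f_def multinom_Cons del: prod.cl_ivl_Suc)
  qed
  have sign: "(-1) ^ n = (-1) ^ i * ((-1) ^ (n - i) :: real)" if "i \<le> n" for i
    using that by (simp flip: power_add)
  have "goncarov_sum (n + Suc (length ws)) u (w # ws) =
      (-1) ^ n * (\<Sum>s\<in>(\<Union>i\<in>?I. (#) i ` ?S i). f n u (Suc (length ws)) s)"
    using gs[of n "w # ws" u] S_set_Cons[of n ws u w] by simp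
  also have "\<dots> = (-1) ^ n * (\<Sum>i\<in>?I. \<Sum>s\<in>(#) i ` ?S i. f n u (Suc (length ws)) s)"
    by (subst sum.UNION_disjoint) (auto simp: finite_S_set)
  also have "\<dots> = (\<Sum>i\<in>?I. (-1) ^ n * (\<Sum>s\<in>?S i. f n u (Suc (length ws)) (i # s)))"
    by (simp add: sum.reindex sum_distrib_left)
  also have "\<dots> = (\<Sum>i\<in>?I. real (n choose i) *
       ((-1) ^ i * poly (goncarov i (\<lambda>j. real (u (Suc j)))) (real (u 0))) *
       goncarov_sum (n - i + length ws) (\<lambda>j. u (Suc i + j)) ws)"
  proof (rule sum.cong[OF refl])
    fix i assume "i \<in> ?I"
    then have i: "i \<le> n" by simp
    show "(-1) ^ n * (\<Sum>s\<in>?S i. f n u (Suc (length ws)) (i # s)) = real (n choose i) *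
       ((-1) ^ i * poly (goncarov i (\<lambda>j. real (u (Suc j)))) (real (u 0))) *
       goncarov_sum (n - i + length ws) (\<lambda>j. u (Suc i + j)) ws"
      unfolding gs f_Cons[OF i] T1 sign[OF i] sum_distrib_left[symmetric] by (simp only: mult_ac)
  qed
  finally show ?thesis .
qed

lemma card_completions:
  assumes "mono u" "sorted w"
  shows "real (card (completions u n w)) = goncarov_sum (n + length w) u w"
  using assms
proof (induction w arbitrary: u n)
  case Nil
  then show ?case by (simp add: card_completions_Nil goncarov_sum_Nil)
next
  case (Cons w ws)
  have IH: "real (card (completions (\<lambda>j. u (Suc i + j)) k ws)) =
      goncarov_sum (k + length ws) (\<lambda>j. u (Suc i + j)) ws" for i k
    using Cons.prems by (intro Cons.IH) (auto simp: mono_def)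
  show ?case
    unfolding card_completions_Cons[OF Cons.prems] length_Cons goncarov_sum_Cons
      of_nat_sum of_nat_mult IH card_completions_Nil[OF Cons.prems(1)] ..
qed

text \<open>
  The partial sums of \<open>s\<close> are at most \<open>m - l\<close>, so no index beyond \<open>m\<close> is ever used. Hence \<open>u\<close> may
  be altered outside \<open>{0..m}\<close>, in particular to make it monotone everywhere.
\<close>

lemma goncarov_sum_cong:
  assumes "length w \<le> m" and uv: "\<And>i. i \<le> m \<Longrightarrow> u i = v i"
  shows "goncarov_sum m u w = goncarov_sum m v w"
proof -
  have bound: "psum s i + length w \<le> m" if "sum_list s = m - length w" for s i
  proof -
    have "psum s i \<le> sum_list s"
      unfolding psum_def by (metis append_take_drop_id le_add1 sum_list_append)
    with that assms(1) show ?thesis by simp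
  qed
  have S: "S_set m u w = S_set m v w"
  proof -
    have "u (psum s i + i) = v (psum s i + i)" if "sum_list s = m - length w" "i \<in> {1..length w}" for s i
      using bound[OF that(1), of i] that(2) by (intro uv) auto
    then show ?thesis unfolding S_set_def by auto
  qed
  have factor: "poly (goncarov (s ! (i - 1)) (\<lambda>j. real (u (psum s (i - 1) + i + j))))
                (real (u (psum s (i - 1) + (i - 1)))) =
        poly (goncarov (s ! (i - 1)) (\<lambda>j. real (v (psum s (i - 1) + i + j))))
                (real (v (psum s (i - 1) + (i - 1))))"
    if s: "s \<in> S_set m v w" and i: "i \<in> {1..length w + 1}" for s i
  proof -
    have sum: "sum_list s = m - length w" and len: "length s = length w + 1"
      using s by (auto simp: S_set_def)
    have "take i s = take (i - 1) s @ [s ! (i - 1)]"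
      using i len take_Suc_conv_app_nth[of "i - 1" s] by auto
    then have psum_i: "psum s i = psum s (i - 1) + s ! (i - 1)" by (simp add: psum_def)
    have "goncarov (s ! (i - 1)) (\<lambda>j. real (u (psum s (i - 1) + i + j))) =
          goncarov (s ! (i - 1)) (\<lambda>j. real (v (psum s (i - 1) + i + j)))"
    proof (rule goncarov_cong)
      fix j assume "j < s ! (i - 1)"
      then have "psum s (i - 1) + i + j \<le> m" using bound[OF sum, of i] psum_i i by auto
      then show "real (u (psum s (i - 1) + i + j)) = real (v (psum s (i - 1) + i + j))"
        using uv by simp
    qed
    moreover have "psum s (i - 1) + (i - 1) \<le> m" using bound[OF sum, of "i - 1"] i by auto
    ultimately show ?thesis using uv by simp
  qed
  show ?thesis unfolding goncarov_sum_def S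
    by (intro arg_cong2[where f = "(*)"] sum.cong prod.cong refl factor)
qed

lemma pf_with_prefix_cong:
  "(\<And>i. i \<le> m \<Longrightarrow> u i = v i) \<Longrightarrow> pf_with_prefix m u w = pf_with_prefix m v w"
  by (auto simp: pf_with_prefix_def parking_functions_def)

section \<open>Dependence on the prefix\<close>

text \<open>
  A sorted prefix with \<open>w\<^sub>i \<le> u\<^sub>i\<close> satisfies the first \<open>l\<close> parking conditions on its own, and all its
  \<open>l\<close> entries are counted in each later one. The right-hand side depends on \<open>w\<close> only through its
  length.
\<close>

lemma completions_eq_of_parked_prefix:
  assumes u: "mono u" and w: "sorted w" "\<And>i. i < length w \<Longrightarrow> w ! i \<le> u (Suc i)"
  shows "completions u n w = {x. length x = n \<and> (\<forall>y\<in>set x. u 0 < y) \<and>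
    (\<forall>j\<in>{Suc (length w)..n + length w}. j \<le> num_le x (u j) + length w)}"
proof -
  have early: "j \<le> num_le w (u j)" if j: "j \<in> {1..length w}" for j
  proof -
    from j have "w ! (j - 1) \<le> u j" using w(2)[of "j - 1"] by auto
    moreover from j have "j - 1 < length w" by auto
    ultimately have "j - 1 < num_le w (u j)"
      using sorted_nth_le_iff_num_le[OF w(1)] by blast
    then show ?thesis by simp
  qed
  have late: "num_le w (u j) = length w" if j: "length w \<le> j" for j
  proof (cases "w = []")
    case False
    then have "length w \<le> num_le w (u (length w))" by (intro early) (simp add: Suc_le_eq)
    also have "\<dots> \<le> num_le w (u j)" using j u by (intro num_le_mono) (simp add: monoD)
    finally show ?thesis using num_le_length[of w "u j"] by simp
  qed simp
  have "(\<forall>j\<in>{1..n + length w}. j \<le> num_le (x @ w) (u j)) \<longleftrightarrow>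
      (\<forall>j\<in>{Suc (length w)..n + length w}. j \<le> num_le x (u j) + length w)" for x
  proof -
    have "j \<le> num_le (x @ w) (u j)" if "j \<in> {1..length w}" for j
      using early[OF that] by simp
    moreover have "{1..n + length w} = {1..length w} \<union> {Suc (length w)..n + length w}" by auto
    ultimately show ?thesis by (simp add: ball_Un late del: One_nat_def)
  qed
  then show ?thesis unfolding completions_def by simp
qed

lemma completions_antimono:
  assumes "list_all2 (\<le>) w w'"
  shows "completions u n w' \<subseteq> completions u n w"
proof -
  have "num_le w' t \<le> num_le w t" for t
    using assms by (induction rule: list_all2_induct) auto
  then have "num_le (x @ w') t \<le> num_le (x @ w) t" for x t by simp
  then show ?thesis
    using list_all2_lengthD[OF assms] by (fastforce simp: completions_def intro: le_trans)
qed

section \<open>Parking functions with a prescribed prefix\<close>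

theorem theorem2p7:
  fixes m l :: nat and u :: "nat \<Rightarrow> nat"
  assumes "1 \<le> m"
    and "u 0 = 0"
    and "\<forall>i\<in>{1..m}. 0 < u i"
    and "strict_mono_on {1..m} u"
    and "1 \<le> l" and "l \<le> m"
  shows "(\<forall>w\<in>prefixes m u l. real (card (pf_with_prefix m u w)) = goncarov_sum m u w) \<and>
    (\<forall>w\<in>prefixes m u l. \<forall>w'\<in>prefixes m u l.
        (\<forall>i\<in>{1..l}. w ! (i - 1) \<le> u i) \<and> (\<forall>i\<in>{1..l}. w' ! (i - 1) \<le> u i) \<longrightarrow>
        card (pf_with_prefix m u w) = card (pf_with_prefix m u w')) \<and>
    (\<forall>w\<in>prefixes m u l. \<forall>w'\<in>prefixes m u l.
        (\<forall>i\<in>{1..l}. w' ! (i - 1) = w ! (i - 1) \<or>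
                     w' ! (i - 1) > w ! (i - 1) \<and> w' ! (i - 1) > u i) \<longrightarrow>
        card (pf_with_prefix m u w') \<le> card (pf_with_prefix m u w))"
proof -
  \<comment> \<open>Keeping \<open>u\<close> constant after index \<open>m\<close> makes it monotone on all of \<open>nat\<close>.\<close>
  define v where "v i = u (min i m)" for i
  have v_eq: "u i = v i" if "i \<le> m" for i using that by (simp add: v_def)
  have "u i \<le> u j" if "i \<le> j" "j \<le> m" for i j
  proof (cases "i = 0 \<or> i = j")
    case False
    then have "u i < u j" using that by (intro strict_mono_onD[OF assms(4)]) auto
    then show ?thesis by simp
  qed (use assms(2) in auto)
  then have v: "mono v" by (auto simp: mono_def v_def min_def)
  have count: "card (pf_with_prefix m u w) = card (completions v (m - l) w)"
    and prefix: "length w = l" "sorted w" if "w \<in> prefixes m u l" for w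
  proof -
    show len: "length w = l" and "sorted w" using that by (auto simp: prefixes_def)
    have "pf_with_prefix m u w = pf_with_prefix m v w" by (rule pf_with_prefix_cong) (rule v_eq)
    moreover have "card (pf_with_prefix m v w) = card (completions v (m - length w) w)"
      using that assms(2,6) by (intro card_pf_with_prefix) (auto simp: prefixes_def v_def)
    ultimately show "card (pf_with_prefix m u w) = card (completions v (m - l) w)" using len by simp
  qed
  show ?thesis
  proof (intro conjI ballI impI)
    fix w assume w: "w \<in> prefixes m u l"
    have "goncarov_sum m u w = goncarov_sum m v w"
      using prefix(1)[OF w] assms(6) by (intro goncarov_sum_cong v_eq) auto
    with card_completions[OF v prefix(2)[OF w], of "m - l"]
    show "real (card (pf_with_prefix m u w)) = goncarov_sum m u w"
      using assms(6) prefix(1)[OF w] by (simp add: count[OF w])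
  next
    fix w w' assume w: "w \<in> prefixes m u l" and w': "w' \<in> prefixes m u l"
      and le: "(\<forall>i\<in>{1..l}. w ! (i - 1) \<le> u i) \<and> (\<forall>i\<in>{1..l}. w' ! (i - 1) \<le> u i)"
    have "w ! i \<le> v (Suc i)" "w' ! i \<le> v (Suc i)" if "i < l" for i
      using bspec[OF conjunct1[OF le], of "Suc i"] bspec[OF conjunct2[OF le], of "Suc i"]
        that assms(6) v_eq[of "Suc i"] by auto
    then have "completions v (m - l) w = completions v (m - l) w'"
      using completions_eq_of_parked_prefix[OF v prefix(2)[OF w], of "m - l"]
        completions_eq_of_parked_prefix[OF v prefix(2)[OF w'], of "m - l"]
        prefix(1)[OF w] prefix(1)[OF w'] by simp
    then show "card (pf_with_prefix m u w) = card (pf_with_prefix m u w')"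
      by (simp add: count[OF w] count[OF w'])
  next
    fix w w' assume w: "w \<in> prefixes m u l" and w': "w' \<in> prefixes m u l"
      and ge: "\<forall>i\<in>{1..l}. w' ! (i - 1) = w ! (i - 1) \<or>
                     w' ! (i - 1) > w ! (i - 1) \<and> w' ! (i - 1) > u i"
    have "w ! i \<le> w' ! i" if "i < l" for i
      using bspec[OF ge, of "Suc i"] that by auto
    then have "list_all2 (\<le>) w w'"
      using prefix(1)[OF w] prefix(1)[OF w'] by (simp add: list_all2_conv_all_nth)
    from card_mono[OF finite_completions completions_antimono[OF this]]
    show "card (pf_with_prefix m u w') \<le> card (pf_with_prefix m u w)"
      by (simp add: count[OF w] count[OF w'])
  qed
qed

end
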